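(* Let $m\geq 2$ and $p\geq 1$ be integers and let $x:\mathcal{L}\to\hat{\mathbb{C}}$ satisfy the dSKP recurrence. For $(i,j)\in\mathbb{Z}^2$ put $a_{i,j}=x(i,j,[i+j]_2)$. Suppose that $a_{i,j}=a_{i+m,j+m}$ for all $(i,j)\in\mathbb{Z}^2$, and that $a_{i,j}=a_{i+1,j+1}$ for all $(i,j)\in\mathbb{Z}^2$ with $[i-j]_{2p}=0$ ("$(m,p)$-Devron initial data"). Let $k=(m-2)p+2$. Then for all $(i,j)\in\mathbb{Z}^2$ with $[i-j-mp]_{2p}=0$, $$x(i,j,k)=x(i+1,j+1,k).$$
   Context: $\hat{\mathbb{C}}=\mathbb{C}\cup\{\infty\}$ with the usual arithmetic conventions. $\mathcal{L}=\{(i,j,k)\in\mathbb{Z}^3: i+j+k\in 2\mathbb{Z}\}$ and $(e_1,e_2,e_3)$ is the canonical basis of $\mathbb{Z}^3$. A function $x:\mathcal{L}\to\hat{\mathbb{C}}$ satisfies the dSKP recurrence if for every $p\in\mathbb{Z}^3\setminus\mathcal{L}$, writing $x_q=x(p+q)$ for $q\in\{\pm e_1,\pm e_2,\pm e_3\}$, $$\frac{(x_{-e_3}-x_{e_2})(x_{-e_1}-x_{e_3})(x_{-e_2}-x_{e_1})}{(x_{e_2}-x_{-e_1})(x_{e_3}-x_{-e_2})(x_{e_1}-x_{-e_3})}=-1.$$ For $n\in\mathbb{Z}$ and $r\geq1$, $[n]_r\in\{0,\dots,r-1\}$ denotes the residue of $n$ modulo $r$.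
   Formalization: The form 0/0 is allowed in the dSKP equation (Devron data force a zero denominator on level 0), and it is assumed that at every centre on levels 1 to k-1 the recurrence determines the value at p+e_3 uniquely from the other five; without this the claim fails, e.g. for m=2, p=1. *)

theory Defs
  imports Complex_Main "HOL-Library.Product_Plus"
begin

datatype ext_complex = Fin complex | Infty

text \<open>
  Differences on the extended complex plane are taken with respect to the homogeneous
  coordinates \<open>[z : 1]\<close> of \<open>Fin z\<close> and \<open>[1 : 0]\<close> of \<open>Infty\<close>, that is, as
  2-by-2 determinants.  In the multi-ratio below every point occurs exactly once in the numerator
  and once in the denominator, so the quotient does not depend on the chosen coordinates;
  if a point is infinite, its two factors contribute the usual
  \<open>(a - \<infinity>) / (\<infinity> - b) = -1\<close>.
\<close>

fun ext_diff :: "ext_complex \<Rightarrow> ext_complex \<Rightarrow> complex" where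
  "ext_diff (Fin z) (Fin w) = z - w"
| "ext_diff Infty (Fin w) = 1"
| "ext_diff (Fin z) Infty = - 1"
| "ext_diff Infty Infty = 0"

text \<open>
  \<open>dSKP_rel a b c d e f\<close> says that the multi-ratio of the six points equals \<open>-1\<close>.
  The indeterminate form \<open>0/0\<close> is not considered a violation; it cannot be forbidden at every
  centre, because Devron initial data produce it at centres on level 0.
  A quotient \<open>N/0\<close> with nonzero \<open>N\<close> is infinite and does violate the relation
  (in HOL such a quotient is \<open>0\<close>, hence also different from \<open>-1\<close>).
\<close>

definition dSKP_rel ::
  "ext_complex \<Rightarrow> ext_complex \<Rightarrow> ext_complex \<Rightarrow> ext_complex \<Rightarrow> ext_complex \<Rightarrow> ext_complex \<Rightarrow> bool"
where
  "dSKP_rel a b c d e f \<longleftrightarrow>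
     (let N = ext_diff a b * ext_diff c d * ext_diff e f;
          D = ext_diff b c * ext_diff d e * ext_diff f a
      in (N = 0 \<and> D = 0) \<or> N / D = - 1)"

lemma dSKP_rel_Fin:
  assumes "(b - c) * (d - e) * (f - a) \<noteq> 0"
  shows "dSKP_rel (Fin a) (Fin b) (Fin c) (Fin d) (Fin e) (Fin f) \<longleftrightarrow>
    ((a - b) * (c - d) * (e - f)) / ((b - c) * (d - e) * (f - a)) = - 1"
  using assms by (auto simp: dSKP_rel_def Let_def)

lemma dSKP_rel_iff:
  "dSKP_rel a b c d e f \<longleftrightarrow>
     ext_diff a b * ext_diff c d * ext_diff e f + ext_diff b c * ext_diff d e * ext_diff f a = 0"
proof (cases "ext_diff b c * ext_diff d e * ext_diff f a = 0")
  case True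
  then show ?thesis unfolding dSKP_rel_def Let_def by auto
next
  case False
  then show ?thesis
    unfolding dSKP_rel_def Let_def
    by (metis add_eq_0_iff2 divide_eq_minus_1_iff)
qed

definition oct_lattice :: "(int \<times> int \<times> int) set" where
  "oct_lattice = {(i, j, k). even (i + j + k)}"

definition e1 :: "int \<times> int \<times> int" where "e1 = (1, 0, 0)"
definition e2 :: "int \<times> int \<times> int" where "e2 = (0, 1, 0)"
definition e3 :: "int \<times> int \<times> int" where "e3 = (0, 0, 1)"

text \<open>
  A function on the lattice is represented by a total function on \<open>int \<times> int \<times> int\<close>;
  its values outside \<open>oct_lattice\<close> are never used: all neighbours of a point outside the
  lattice belong to the lattice.
\<close>

definition satisfies_dSKP :: "(int \<times> int \<times> int \<Rightarrow> ext_complex) \<Rightarrow> bool" where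
  "satisfies_dSKP x \<longleftrightarrow>
     (\<forall>q. q \<notin> oct_lattice \<longrightarrow>
        dSKP_rel (x (q - e3)) (x (q + e2)) (x (q - e1)) (x (q + e3)) (x (q - e2)) (x (q + e1)))"

text \<open>
  The recurrence, read as a rule computing the value at \<open>q + e3\<close> from the five other
  values around \<open>q\<close>, has exactly one possible output.  This can fail even where the
  multi-ratio has nonzero denominator: if \<open>x (q - e1) = x (q - e2)\<close> and
  \<open>x (q + e1) = x (q + e2)\<close>, then the relation holds for every value at \<open>q + e3\<close>.
\<close>

definition dSKP_determines_up ::
  "(int \<times> int \<times> int \<Rightarrow> ext_complex) \<Rightarrow> int \<times> int \<times> int \<Rightarrow> bool" where
  "dSKP_determines_up x q \<longleftrightarrow>
     (\<exists>!y. dSKP_rel (x (q - e3)) (x (q + e2)) (x (q - e1)) y (x (q - e2)) (x (q + e1)))"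

definition initial_data :: "(int \<times> int \<times> int \<Rightarrow> ext_complex) \<Rightarrow> int \<Rightarrow> int \<Rightarrow> ext_complex" where
  "initial_data x i j = x (i, j, (i + j) mod 2)"

definition Devron_data :: "int \<Rightarrow> int \<Rightarrow> (int \<Rightarrow> int \<Rightarrow> ext_complex) \<Rightarrow> bool" where
  "Devron_data m p a \<longleftrightarrow>
     (\<forall>i j. a i j = a (i + m) (j + m)) \<and>
     (\<forall>i j. (i - j) mod (2 * p) = 0 \<longrightarrow> a i j = a (i + 1) (j + 1))"

end

theory Submission
  imports Defs
begin

text \<open>
  For \<open>0 \<le> l < k\<close>, the points on levels \<open>l\<close> and \<open>l + 1\<close> above an infinite diagonal strip are the
  edges of a ladder-like grid with \<open>k - l\<close> columns: points on level \<open>l + 1\<close> are vertical edges,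
  points on level \<open>l\<close> are horizontal edges.  A flow assigns a weight to every edge such that the
  weights multiplied by homogeneous coordinates of the points obey Kirchhoff's law, as vectors, at
  every node.  The dSKP relation is precisely what is needed to push a flow from level \<open>l\<close> to
  level \<open>l + 1\<close>, at the cost of one column.  At \<open>l = k - 1\<close> a single column without horizontal
  edges is left, on which a nonzero flow forces all points to coincide.

  It remains to find a nonzero flow for \<open>l = 0\<close>.  Look for one of period \<open>m\<close>: there are
  \<open>k m + (k - 1) m\<close> unknowns and \<open>2 k m\<close> scalar equations.  Two equations are redundant since
  nothing leaves the strip, and each of the \<open>m - 1\<close> columns of horizontal edges on which the Devron
  data are constant makes one more redundant: the net vector crossing it is a multiple of the
  constant.  So the unknowns outnumber the equations.
\<close>

section \<open>Homogeneous coordinates and the sixth point of a dSKP relation\<close>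

text \<open>Homogeneous coordinates: \<open>True\<close> selects the first one, \<open>False\<close> the second one.\<close>

fun hc :: "bool \<Rightarrow> ext_complex \<Rightarrow> complex" where
  "hc True (Fin z) = z"
| "hc False (Fin z) = 1"
| "hc True Infty = 1"
| "hc False Infty = 0"

lemma ext_diff_eq_hc: "ext_diff a b = hc True a * hc False b - hc False a * hc True b"
  by (cases a; cases b) simp_all

lemma hc_nonzero: "\<exists>e. hc e a \<noteq> 0"
  by (cases a) (auto intro: exI[of _ False] exI[of _ True])

lemma ext_diff_eq_0_iff: "ext_diff a b = 0 \<longleftrightarrow> a = b"
  by (cases a; cases b) simp_all

lemma hc_proportional:
  assumes "r \<noteq> 0" and "\<And>e. r * hc e a = s * hc e b"
  shows "a = b"
proof -
  have "r * ext_diff a b = 0"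
    using assms(2)[of True] assms(2)[of False] unfolding ext_diff_eq_hc by algebra
  with assms(1) show ?thesis by (simp add: ext_diff_eq_0_iff)
qed

lemma ext_diff_self [simp]: "ext_diff a a = 0"
  by (simp add: ext_diff_eq_0_iff)

lemma ext_diff_commute: "ext_diff b a = - ext_diff a b"
  by (simp add: ext_diff_eq_hc)

text \<open>For fixed \<open>w\<close>, \<open>ext_diff _ w\<close> is linear in the coordinate
  vector, so vector identities can be paired with any point; pairing with one of the points involved
  removes its term.\<close>

lemma ext_diff_relation:
  assumes "\<And>e. a * hc e p - b * hc e q = c * hc e r - d * hc e s"
  shows "a * ext_diff p w - b * ext_diff q w = c * ext_diff r w - d * ext_diff s w"
proof -
  have "a * ext_diff p w - b * ext_diff q w
      = (a * hc True p - b * hc True q) * hc False w - (a * hc False p - b * hc False q) * hc True w"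
    by (simp add: ext_diff_eq_hc algebra_simps)
  also have "\<dots> = c * ext_diff r w - d * ext_diff s w"
    unfolding assms by (simp add: ext_diff_eq_hc algebra_simps)
  finally show ?thesis .
qed

text \<open>
  Homogeneous coordinates of the point determined by dSKP from five others: the relation is the
  vanishing of the determinant of this vector and the sixth point.
\<close>

definition sixth :: "bool \<Rightarrow> ext_complex \<Rightarrow> ext_complex \<Rightarrow> ext_complex \<Rightarrow> ext_complex \<Rightarrow> ext_complex \<Rightarrow> complex"
  where "sixth e z a b c d =
    ext_diff z b * ext_diff d c * hc e a + ext_diff a b * ext_diff c z * hc e d"

text \<open>The same vector expanded in \<open>b\<close> and \<open>c\<close> instead of
  \<open>a\<close> and \<open>d\<close>. With one form for a cell and the other for the cell above,
  both are written in the edges they share.\<close>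

lemma sixth_eq:
  "sixth e z a b c d = ext_diff z a * ext_diff d c * hc e b + ext_diff a b * ext_diff d z * hc e c"
  by (cases e) (simp_all add: sixth_def ext_diff_eq_hc algebra_simps)

lemma dSKP_rel_sixth:
  "dSKP_rel z b a y d c \<longleftrightarrow>
     sixth True z a b c d * hc False y - sixth False z a b c d * hc True y = 0"
  unfolding dSKP_rel_iff sixth_def ext_diff_eq_hc by (simp add: algebra_simps)

text \<open>Uniqueness excludes the zero vector, which would admit every point; a nonzero vector
  with vanishing determinant against \<open>y\<close> is a multiple of \<open>y\<close>.\<close>

lemma sixth_determined:
  assumes "\<exists>!y. dSKP_rel z b a y d c" and rel: "dSKP_rel z b a y d c"
  obtains r where "r \<noteq> 0" and "\<And>e. sixth e z a b c d = r * hc e y"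
proof -
  let ?s = "\<lambda>e. sixth e z a b c d"
  have "\<not> (?s True = 0 \<and> ?s False = 0)"
  proof
    assume "?s True = 0 \<and> ?s False = 0"
    then have "dSKP_rel z b a w d c" for w by (simp add: dSKP_rel_sixth)
    then have "Fin 0 = Fin 1" using assms(1) by blast
    then show False by simp
  qed
  moreover have "?s True * hc False y = ?s False * hc True y"
    using rel by (simp add: dSKP_rel_sixth)
  ultimately show thesis
  proof (cases y)
    case (Fin w)
    with \<open>?s True * hc False y = ?s False * hc True y\<close> have "?s True = ?s False * w" by simp
    moreover from this have "sixth e z a b c d = ?s False * hc e y" for e
      using Fin by (cases e) auto
    moreover have "?s False \<noteq> 0"
      using calculation(1) \<open>\<not> (?s True = 0 \<and> ?s False = 0)\<close> by auto
    ultimately show thesis by (intro that)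
  next
    case Infty
    with \<open>?s True * hc False y = ?s False * hc True y\<close> have "?s False = 0" by simp
    moreover from this have "sixth e z a b c d = ?s True * hc e y" for e
      using Infty by (cases e) auto
    moreover have "?s True \<noteq> 0"
      using calculation(1) \<open>\<not> (?s True = 0 \<and> ?s False = 0)\<close> by auto
    ultimately show thesis by (intro that)
  qed
qed

section \<open>Homogeneous linear systems with more unknowns than equations\<close>

text \<open>Elimination: \<open>f1\<close> and \<open>f2\<close> solve the old equations and only
  \<open>f1\<close> is nonzero at \<open>i1\<close>. Either \<open>f2\<close> solves the new
  equation, or a combination does that is nonzero at \<open>i1\<close>.\<close>

lemma nontrivial_solution:
  fixes L :: "'j \<Rightarrow> ('i \<Rightarrow> complex) \<Rightarrow> complex"
  assumes "finite J" "finite I" "card J < card I"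
    and "\<And>j f g a b. j \<in> J \<Longrightarrow> L j (\<lambda>i. a * f i + b * g i) = a * L j f + b * L j g"
  shows "\<exists>f. (\<forall>i. i \<notin> I \<longrightarrow> f i = 0) \<and> (\<exists>i. f i \<noteq> 0) \<and> (\<forall>j\<in>J. L j f = 0)"
  using assms
proof (induction J arbitrary: I rule: finite_induct)
  case empty
  then obtain i where "i \<in> I" by (metis card.empty card_gt_0_iff ex_in_conv)
  then show ?case by (intro exI[of _ "\<lambda>i'. if i' = i then 1 else 0"]) auto
next
  case (insert j J)
  have IH: "\<exists>f. (\<forall>i. i \<notin> I - {i0} \<longrightarrow> f i = 0) \<and> (\<exists>i. f i \<noteq> 0) \<and> (\<forall>j\<in>J. L j f = 0)"
    if "i0 \<in> I" for i0
    using that insert.prems insert.hyps by (intro insert.IH) auto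
  obtain i0 where "i0 \<in> I" using insert.prems by fastforce
  from IH[OF this] obtain f1 i1 where f1: "\<And>i. i \<notin> I \<Longrightarrow> f1 i = 0" "f1 i1 \<noteq> 0"
    "\<And>j. j \<in> J \<Longrightarrow> L j f1 = 0" by (metis Diff_iff)
  then have "i1 \<in> I" by metis
  from IH[OF this] obtain f2 where f2: "\<And>i. i \<notin> I \<Longrightarrow> f2 i = 0" "f2 i1 = 0" "\<exists>i. f2 i \<noteq> 0"
    "\<And>j. j \<in> J \<Longrightarrow> L j f2 = 0" by (metis Diff_iff singletonI)
  show ?case
  proof (cases "L j f2 = 0")
    case True
    with f2 show ?thesis by (intro exI[of _ f2]) auto
  next
    case False
    define f where "f i = L j f2 * f1 i + (- L j f1) * f2 i" for i
    have "L j' f = L j f2 * L j' f1 + (- L j f1) * L j' f2" if "j' \<in> insert j J" for j'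
      unfolding f_def using that by (rule insert.prems)
    then have "\<forall>j'\<in>insert j J. L j' f = 0" using f1(3) f2(4) by auto
    moreover have "f i1 \<noteq> 0" using False f1(2) f2(2) by (simp add: f_def)
    moreover have "\<forall>i. i \<notin> I \<longrightarrow> f i = 0" using f1(1) f2(1) by (simp add: f_def)
    ultimately show ?thesis by blast
  qed
qed

section \<open>Flows on a strip and their passage to the next level\<close>

text \<open>
  The flow through one row of nodes is a combination of the flows supported on two adjacent columns;
  the coefficients become the weights of the vertical edges one level up.  A column with
  \<open>A c = B c\<close> is harmless only at the two ends of the row.
\<close>

lemma row_decomposition:
  fixes A B Z :: "int \<Rightarrow> ext_complex" and \<alpha> \<beta> \<mu> :: "int \<Rightarrow> complex" and N :: int
  assumes N: "N \<ge> 1"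
    and row: "\<And>e c. 0 \<le> c \<Longrightarrow> c \<le> N \<Longrightarrow> \<alpha> c * hc e (A c) - \<beta> c * hc e (B c)
        = \<mu> c * hc e (Z c) - \<mu> (c - 1) * hc e (Z (c - 1))"
    and ends: "\<mu> (- 1) = 0" "\<mu> N = 0"
    and inner: "\<And>c. 0 < c \<Longrightarrow> c < N \<Longrightarrow> A c \<noteq> B c"
    and det: "\<And>c. 0 \<le> c \<Longrightarrow> c < N \<Longrightarrow> \<exists>e. sixth e (Z c) (A c) (B c) (B (c + 1)) (A (c + 1)) \<noteq> 0"
  obtains \<tau> where "\<tau> (- 1) = 0" "\<tau> N = 0"
    and "\<And>c. 0 \<le> c \<Longrightarrow> c \<le> N \<Longrightarrow> \<alpha> c =
      \<tau> c * (ext_diff (Z c) (B c) * ext_diff (A (c + 1)) (B (c + 1)))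
      + \<tau> (c - 1) * (ext_diff (A (c - 1)) (B (c - 1)) * ext_diff (B c) (Z (c - 1)))"
    and "\<And>c. 0 \<le> c \<Longrightarrow> c \<le> N \<Longrightarrow> \<beta> c =
      \<tau> c * (ext_diff (Z c) (A c) * ext_diff (A (c + 1)) (B (c + 1)))
      + \<tau> (c - 1) * (ext_diff (A (c - 1)) (B (c - 1)) * ext_diff (A c) (Z (c - 1)))"
proof -
  define \<delta> where "\<delta> c = ext_diff (A c) (B c)" for c
  have \<delta>inner: "\<delta> c \<noteq> 0" if "0 < c" "c < N" for c
    using inner[OF that] by (simp add: \<delta>_def ext_diff_eq_0_iff)
  have eqZ: "\<alpha> c * ext_diff (A c) w - \<beta> c * ext_diff (B c) w
       = \<mu> c * ext_diff (Z c) w - \<mu> (c - 1) * ext_diff (Z (c - 1)) w"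
    if "0 \<le> c" "c \<le> N" for c w
    by (rule ext_diff_relation) (rule row[OF that])
  have eqB: "\<alpha> c * \<delta> c = \<mu> c * ext_diff (Z c) (B c) - \<mu> (c - 1) * ext_diff (Z (c - 1)) (B c)"
    and eqA: "\<beta> c * \<delta> c = \<mu> c * ext_diff (Z c) (A c) - \<mu> (c - 1) * ext_diff (Z (c - 1)) (A c)"
    if "0 \<le> c" "c \<le> N" for c
    using eqZ[OF that, of "B c"] eqZ[OF that, of "A c"]
    by (simp_all add: \<delta>_def ext_diff_commute[of "B c" "A c"])
  \<comment> \<open>A degenerate column kills one term of \<open>sixth\<close>, so
    \<open>det\<close> makes every factor of the other term nonzero.\<close>
  have degenerate_left: "\<delta> (c + 1) \<noteq> 0 \<and> ext_diff (Z c) (B c) \<noteq> 0"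
    if "0 \<le> c" "c < N" "\<delta> c = 0" for c
    using det[OF that(1,2)] that(3) by (auto simp: sixth_def \<delta>_def)
  have degenerate_right: "ext_diff (B (c + 1)) (Z c) \<noteq> 0"
    if "0 \<le> c" "c < N" "\<delta> (c + 1) = 0" for c
    using det[OF that(1,2)] that(3) by (auto simp: sixth_def \<delta>_def)
  \<comment> \<open>The generic value is forced by \<open>\<mu>\<close>. Next to a degenerate end
    column \<open>\<mu>\<close> is zero and carries no information, so the vertical weight fixes
    \<open>\<tau>\<close> there.\<close>
  define \<tau> where "\<tau> c = (if c < 0 \<or> c \<ge> N then 0
      else if \<delta> c = 0 then \<alpha> c / (ext_diff (Z c) (B c) * \<delta> (c + 1))
      else if \<delta> (c + 1) = 0 then \<alpha> (c + 1) / (\<delta> c * ext_diff (B (c + 1)) (Z c))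
      else \<mu> c / (\<delta> c * \<delta> (c + 1)))" for c
  have \<mu>: "\<mu> c = \<tau> c * (\<delta> c * \<delta> (c + 1))" if "- 1 \<le> c" "c \<le> N" for c
  proof -
    consider "c = -1" | "c = N" | "0 \<le> c" "c < N" "\<delta> c = 0" | "0 \<le> c" "c < N" "\<delta> (c + 1) = 0"
      | "0 \<le> c" "c < N" "\<delta> c \<noteq> 0" "\<delta> (c + 1) \<noteq> 0" using \<open>- 1 \<le> c\<close> \<open>c \<le> N\<close> by linarith
    then show ?thesis
    proof cases
      case 3
      then have "c = 0" using \<delta>inner by force
      with 3 eqB[of c] degenerate_left[of c] ends show ?thesis by simp
    next
      case 4
      then have "c = N - 1" using \<delta>inner[of "c + 1"] by force
      with 4 eqB[of "c + 1"] degenerate_right[of c] ends show ?thesis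
        by (auto simp: ext_diff_eq_0_iff)
    qed (use ends N in \<open>auto simp: \<tau>_def\<close>)
  qed
  have main: "\<alpha> c = \<tau> c * (ext_diff (Z c) (B c) * \<delta> (c + 1))
      + \<tau> (c - 1) * (\<delta> (c - 1) * ext_diff (B c) (Z (c - 1))) \<and>
    \<beta> c = \<tau> c * (ext_diff (Z c) (A c) * \<delta> (c + 1))
      + \<tau> (c - 1) * (\<delta> (c - 1) * ext_diff (A c) (Z (c - 1)))"
    if c: "0 \<le> c" "c \<le> N" for c
  proof -
    have \<mu>c: "\<mu> c = \<tau> c * (\<delta> c * \<delta> (c + 1))" "\<mu> (c - 1) = \<tau> (c - 1) * (\<delta> (c - 1) * \<delta> c)"
      using \<mu>[of c] \<mu>[of "c - 1"] c by simp_all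
    consider "\<delta> c \<noteq> 0" | "\<delta> c = 0" "c = 0" | "\<delta> c = 0" "c = N" using \<delta>inner[of c] c by linarith
    then show ?thesis
    proof cases
      case 1
      have "\<alpha> c * \<delta> c = (\<tau> c * (ext_diff (Z c) (B c) * \<delta> (c + 1))
          + \<tau> (c - 1) * (\<delta> (c - 1) * ext_diff (B c) (Z (c - 1)))) * \<delta> c"
        using eqB[OF c] ext_diff_commute[of "B c" "Z (c - 1)"] unfolding \<mu>c by algebra
      moreover have "\<beta> c * \<delta> c = (\<tau> c * (ext_diff (Z c) (A c) * \<delta> (c + 1))
          + \<tau> (c - 1) * (\<delta> (c - 1) * ext_diff (A c) (Z (c - 1)))) * \<delta> c"
        using eqA[OF c] ext_diff_commute[of "A c" "Z (c - 1)"] unfolding \<mu>c by algebra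
      ultimately show ?thesis using 1 by simp
    next
      case 2
      note d = degenerate_left[of c]
      have "\<tau> (c - 1) = 0" using 2 by (simp add: \<tau>_def)
      moreover have a: "\<alpha> c = \<tau> c * (ext_diff (Z c) (B c) * \<delta> (c + 1))"
        using 2 N d by (simp add: \<tau>_def)
      moreover have "\<beta> c * ext_diff (Z c) (B c) = \<alpha> c * ext_diff (Z c) (A c)"
        using eqZ[OF c, of "Z c"] \<mu>c 2 c ends
        by (simp add: ext_diff_commute[of "A 0" "Z 0"] ext_diff_commute[of "B 0" "Z 0"]
            ext_diff_eq_0_iff)
      ultimately show ?thesis using d 2 N by (simp add: a algebra_simps)
    next
      case 3
      have d: "ext_diff (B c) (Z (c - 1)) \<noteq> 0" using degenerate_right[of "c - 1"] 3 N by simp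
      have d1: "\<delta> (c - 1) \<noteq> 0" using degenerate_left[of "c - 1"] 3 N by auto
      have t: "\<tau> c = 0" using 3 by (simp add: \<tau>_def)
      have a: "\<alpha> c = \<tau> (c - 1) * (\<delta> (c - 1) * ext_diff (B c) (Z (c - 1)))"
        using 3 N d d1 by (simp add: \<tau>_def)
      have "\<beta> c * ext_diff (B c) (Z (c - 1)) = \<alpha> c * ext_diff (A c) (Z (c - 1))"
        using eqZ[OF c, of "Z (c - 1)"] \<mu>c 3 c ends
        by (simp add: ext_diff_eq_0_iff)
      then show ?thesis using d t by (simp add: a algebra_simps)
    qed
  qed
  have "\<tau> (- 1) = 0" "\<tau> N = 0" by (simp_all add: \<tau>_def)
  then show thesis
    by (rule that) (fact main[unfolded \<delta>_def, THEN conjunct1] main[unfolded \<delta>_def, THEN conjunct2])+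
qed

text \<open>
  In column \<open>c\<close> the node in row \<open>n\<close> has the vertical edges \<open>V c n\<close> (below) and \<open>V c (n + 1)\<close> (above)
  and the horizontal edges \<open>H (c - 1) n\<close> (left) and \<open>H c n\<close> (right); the columns are \<open>0, ..., N\<close>.
\<close>

definition strip_flow :: "int \<Rightarrow> (int \<Rightarrow> int \<Rightarrow> ext_complex) \<Rightarrow> (int \<Rightarrow> int \<Rightarrow> ext_complex) \<Rightarrow>
    (int \<Rightarrow> int \<Rightarrow> complex) \<Rightarrow> (int \<Rightarrow> int \<Rightarrow> complex) \<Rightarrow> bool" where
  "strip_flow N V H f g \<longleftrightarrow>
     (\<forall>n. g (- 1) n = 0 \<and> g N n = 0) \<and>
     (\<forall>e n. \<forall>c\<in>{0..N}. f c n * hc e (V c n) - f c (n + 1) * hc e (V c (n + 1))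
        = g c n * hc e (H c n) - g (c - 1) n * hc e (H (c - 1) n))"

text \<open>A vertical edge lies in two adjacent rows, and equating the two decompositions of its
  weight gives Kirchhoff's law one level up, where it has become a horizontal edge.\<close>

lemma strip_flow_step:
  fixes V H V' :: "int \<Rightarrow> int \<Rightarrow> ext_complex"
  assumes N: "N \<ge> 1" and flow: "strip_flow N V H f g"
    and nz: "\<exists>c\<in>{0..N}. \<exists>n. f c n \<noteq> 0"
    and det: "\<And>c n. 0 \<le> c \<Longrightarrow> c < N \<Longrightarrow>
      \<exists>!y. dSKP_rel (H c n) (V c (n + 1)) (V c n) y (V (c + 1) n) (V (c + 1) (n + 1))"
    and rel: "\<And>c n. 0 \<le> c \<Longrightarrow> c < N \<Longrightarrow>
      dSKP_rel (H c n) (V c (n + 1)) (V c n) (V' c n) (V (c + 1) n) (V (c + 1) (n + 1))"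
    and det': "\<And>c n. 0 \<le> c \<Longrightarrow> c + 1 < N \<Longrightarrow>
      \<exists>!y. dSKP_rel (V (c + 1) (n + 1)) (V' c (n + 1)) (V' c n) y (V' (c + 1) n) (V' (c + 1) (n + 1))"
  obtains f' g' where "strip_flow (N - 1) V' (\<lambda>c n. V (c + 1) (n + 1)) f' g'"
    and "\<exists>c\<in>{0..N - 1}. \<exists>n. f' c n \<noteq> 0"
proof -
  let ?P = "\<lambda>e c n. sixth e (H c n) (V c n) (V c (n + 1)) (V (c + 1) (n + 1)) (V (c + 1) n)"
  have "\<exists>r. r \<noteq> 0 \<and> (\<forall>e. ?P e c n = r * hc e (V' c n))" if "0 \<le> c" "c < N" for c n
    using sixth_determined[OF det[OF that, of n] rel[OF that, of n]] by metis
  then obtain r where r: "\<And>c n. 0 \<le> c \<Longrightarrow> c < N \<Longrightarrow> r c n \<noteq> 0"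
      "\<And>c n e. 0 \<le> c \<Longrightarrow> c < N \<Longrightarrow> ?P e c n = r c n * hc e (V' c n)" by metis
  have row: "f c n * hc e (V c n) - f c (n + 1) * hc e (V c (n + 1))
        = g c n * hc e (H c n) - g (c - 1) n * hc e (H (c - 1) n)"
    if "0 \<le> c" "c \<le> N" for e c n using flow that by (auto simp: strip_flow_def)
  have ends: "g (- 1) n = 0" "g N n = 0" for n using flow by (auto simp: strip_flow_def)
  \<comment> \<open>Otherwise \<open>V' (c - 1) n\<close>, \<open>V' c n\<close> and \<open>V c (n + 1)\<close> coincide, and dSKP says nothing one level up.\<close>
  have inner: "V c n \<noteq> V c (n + 1)" if c: "0 < c" "c < N" for c n
  proof
    assume eq: "V c n = V c (n + 1)"
    define v where "v = V c n"
    have v: "V c n = v" "V c (n + 1) = v" using eq by (simp_all add: v_def)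
    have right: "r c n * hc e (V' c n)
        = (ext_diff (H c n) v * ext_diff (V (c + 1) n) (V (c + 1) (n + 1))) * hc e v" for e
      using r(2)[of c e n] c by (simp add: sixth_def v)
    have left: "r (c - 1) n * hc e (V' (c - 1) n)
        = (ext_diff (V (c - 1) n) (V (c - 1) (n + 1)) * ext_diff v (H (c - 1) n)) * hc e v" for e
      using r(2)[of "c - 1" e n] c by (simp add: sixth_def v)
    have "V' c n = v" by (rule hc_proportional[OF r(1) right]) (use c in auto)
    moreover have "V' (c - 1) n = v" by (rule hc_proportional[OF r(1) left]) (use c in auto)
    ultimately have "\<exists>!y. dSKP_rel v (V' (c - 1) (n + 1)) v y v (V' c (n + 1))"
      using det'[of "c - 1" n] c by (simp add: v)
    moreover have "dSKP_rel v b v y v d" for b y d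
      by (simp add: dSKP_rel_iff ext_diff_eq_hc algebra_simps)
    ultimately have "Fin 0 = Fin 1" by blast
    then show False by simp
  qed
  have "\<exists>t. t (- 1) = 0 \<and> t N = 0 \<and> (\<forall>c. 0 \<le> c \<longrightarrow> c \<le> N \<longrightarrow> f c n =
      t c * (ext_diff (H c n) (V c (n + 1)) * ext_diff (V (c + 1) n) (V (c + 1) (n + 1)))
      + t (c - 1) * (ext_diff (V (c - 1) n) (V (c - 1) (n + 1)) * ext_diff (V c (n + 1)) (H (c - 1) n)))
    \<and> (\<forall>c. 0 \<le> c \<longrightarrow> c \<le> N \<longrightarrow> f c (n + 1) =
      t c * (ext_diff (H c n) (V c n) * ext_diff (V (c + 1) n) (V (c + 1) (n + 1)))
      + t (c - 1) * (ext_diff (V (c - 1) n) (V (c - 1) (n + 1)) * ext_diff (V c n) (H (c - 1) n)))"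
    for n
  proof -
    have nz: "\<exists>e. ?P e c n \<noteq> 0" if "0 \<le> c" "c < N" for c
      using r(1)[OF that, of n] r(2)[OF that, of _ n] hc_nonzero[of "V' c n"] by auto
    show ?thesis
      by (rule row_decomposition[of N "\<lambda>c. f c n" "\<lambda>c. V c n" "\<lambda>c. f c (n + 1)"
            "\<lambda>c. V c (n + 1)" "\<lambda>c. g c n" "\<lambda>c. H c n"])
        (use N row ends inner nz in auto)
  qed
  then obtain t where t: "\<And>n. t n (- 1) = 0" "\<And>n. t n N = 0"
    and low: "\<And>c n. 0 \<le> c \<Longrightarrow> c \<le> N \<Longrightarrow> f c n =
      t n c * (ext_diff (H c n) (V c (n + 1)) * ext_diff (V (c + 1) n) (V (c + 1) (n + 1)))
      + t n (c - 1) * (ext_diff (V (c - 1) n) (V (c - 1) (n + 1)) * ext_diff (V c (n + 1)) (H (c - 1) n))"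
    and up: "\<And>c n. 0 \<le> c \<Longrightarrow> c \<le> N \<Longrightarrow> f c (n + 1) =
      t n c * (ext_diff (H c n) (V c n) * ext_diff (V (c + 1) n) (V (c + 1) (n + 1)))
      + t n (c - 1) * (ext_diff (V (c - 1) n) (V (c - 1) (n + 1)) * ext_diff (V c n) (H (c - 1) n))"
    by metis
  define f' where "f' c n = t n c * r c n" for c n
  define g' where "g' c n =
      t n c * (ext_diff (V c n) (V c (n + 1)) * ext_diff (V (c + 1) n) (H c n))
      - t (n + 1) c * (ext_diff (V c (n + 1)) (V c (n + 1 + 1)) * ext_diff (V (c + 1) (n + 1 + 1)) (H c (n + 1)))"
    for c n
  \<comment> \<open>Comparing \<open>f c (n + 1)\<close> as seen from rows \<open>n\<close> and
    \<open>n + 1\<close> expresses the horizontal weight to the left of cell \<open>c\<close> by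
    \<open>t\<close> at \<open>c\<close>.\<close>
  have g'_left: "g' (c - 1) n = - (t n c * (ext_diff (H c n) (V c n) * ext_diff (V (c + 1) n) (V (c + 1) (n + 1)))
      - t (n + 1) c * (ext_diff (H c (n + 1)) (V c (n + 1 + 1)) * ext_diff (V (c + 1) (n + 1)) (V (c + 1) (n + 1 + 1))))"
    if "0 \<le> c" "c \<le> N" for c n
    using low[OF that, of "n + 1"] up[OF that, of n] by (simp add: g'_def algebra_simps)
  have "strip_flow (N - 1) V' (\<lambda>c n. V (c + 1) (n + 1)) f' g'"
    unfolding strip_flow_def
  proof (intro conjI allI ballI)
    fix n
    show "g' (- 1) n = 0" using t by (simp add: g'_def)
    show "g' (N - 1) n = 0" using g'_left[of N n] t N by simp
  next
    fix e n c assume "c \<in> {0..N - 1}"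
    then have c: "0 \<le> c" "c < N" by auto
    have "f' c n * hc e (V' c n) - f' c (n + 1) * hc e (V' c (n + 1))
        = t n c * ?P e c n - t (n + 1) c * ?P e c (n + 1)"
      by (simp only: f'_def r(2)[OF c] mult.assoc)
    also have "\<dots> = g' c n * hc e (V (c + 1) (n + 1)) - g' (c - 1) n * hc e (V c (n + 1))"
      unfolding g'_left[OF c(1) less_imp_le[OF c(2)]] g'_def[of c n]
        sixth_eq[of e "H c n"] sixth_def[of e "H c (n + 1)"] by algebra
    finally show "f' c n * hc e (V' c n) - f' c (n + 1) * hc e (V' c (n + 1))
       = g' c n * hc e (V (c + 1) (n + 1)) - g' (c - 1) n * hc e (V (c - 1 + 1) (n + 1))" by simp
  qed
  moreover have "\<exists>c\<in>{0..N - 1}. \<exists>n. f' c n \<noteq> 0"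
  proof (rule ccontr)
    assume z: "\<not> ?thesis"
    \<comment> \<open>As \<open>r\<close> is nonzero, vanishing new weights force \<open>t\<close>,
      and then \<open>f\<close>, to vanish.\<close>
    have "t n c = 0" if "- 1 \<le> c" "c \<le> N" for c n
    proof -
      consider "c = - 1" | "c = N" | "0 \<le> c" "c < N" using \<open>- 1 \<le> c\<close> \<open>c \<le> N\<close> by linarith
      then show ?thesis using t r(1)[of c n] z by cases (auto simp: f'_def)
    qed
    then have "f c n = 0" if "0 \<le> c" "c \<le> N" for c n
      using low[OF that] that by simp
    with nz show False by auto
  qed
  ultimately show thesis by (rule that)
qed

section \<open>A nonzero periodic flow from Devron data\<close>

lemma periodic_shift:
  fixes m :: int
  assumes "\<And>n. F (n + m) = F n"
  shows "F (n + q * m) = F n"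
proof (induction q rule: int_induct[where k = 0])
  case (step1 q)
  with assms[of "n + q * m"] show ?case by (simp add: algebra_simps)
next
  case (step2 q)
  with assms[of "n + (q - 1) * m"] show ?case by (simp add: algebra_simps)
qed simp

lemma sum_telescope_int:
  fixes F :: "int \<Rightarrow> complex"
  assumes "m \<ge> 0"
  shows "(\<Sum>n\<in>{0..<m}. F n - F (n + 1)) = F 0 - F m"
  using assms
proof (induction m rule: int_ge_induct)
  case (step m)
  then have "{0..<m + 1} = insert m {0..<m}" by auto
  with step show ?case by simp
qed simp

lemma Devron_strip_flow:
  fixes V H :: "int \<Rightarrow> int \<Rightarrow> ext_complex" and m p k :: int
  assumes m: "m \<ge> 2" and p: "p \<ge> 1" and k: "k = (m - 2) * p + 2"
    and perV: "\<And>c n. V c (n + m) = V c n" and perH: "\<And>c n. H c (n + m) = H c n"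
    and const: "\<And>c n. p dvd c \<Longrightarrow> H c (n + 1) = H c n"
  obtains f g where "strip_flow (k - 1) V H f g" and "\<exists>c\<in>{0..k - 1}. \<exists>n. f c n \<noteq> 0"
proof -
  have "k \<ge> 2" using m p k by simp
  define I where "I = {False} \<times> {0..<k} \<times> {0..<m} \<union> {True} \<times> {0..<k - 1} \<times> {0..<m}"
  \<comment> \<open>\<open>D\<close> lists the redundant equations.  At a node of \<open>J\<close>, \<open>L\<close> imposes the determinant of the residual
    with the horizontal edge and, independently of it, one coordinate of the residual.\<close>
  define D where "D = (\<lambda>t. (True, t * p, 0 :: int)) ` {0..<m - 1} \<union> {(True, k - 1, 0), (False, k - 1, 0)}"
  define J where "J = UNIV \<times> {0..<k} \<times> {0..<m} - D"
  define res where "res \<phi> e c n = \<phi> (False, c, n mod m) * hc e (V c n)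
      - \<phi> (False, c, (n + 1) mod m) * hc e (V c (n + 1))
      - \<phi> (True, c, n mod m) * hc e (H c n)
      + \<phi> (True, c - 1, n mod m) * hc e (H (c - 1) n)"
    for \<phi> :: "bool \<times> int \<times> int \<Rightarrow> complex" and e c n
  define L where "L = (\<lambda>(b, c, n) \<phi>.
      if b then hc True (H c 0) * res \<phi> False c n - hc False (H c 0) * res \<phi> True c n
      else res \<phi> (H c 0 = Infty) c n)"
  \<comment> \<open>Here the value of \<open>k\<close> matters: the constant columns
    \<open>0, p, ..., (m - 2) * p\<close> end exactly at \<open>k - 2\<close>, the last column of
    horizontal edges.\<close>
  have tp: "t * p < k - 1" if "t < m - 1" for t
    using that p mult_right_mono[of t "m - 2" p] unfolding k by linarith
  \<comment> \<open>\<open>I\<close> has \<open>(2 * k - 1) * m\<close> elements and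
    \<open>J\<close> has \<open>2 * k * m - m - 1\<close>, exactly one fewer.\<close>
  have "card J < card I"
  proof -
    have "D \<subseteq> UNIV \<times> {0..<k} \<times> {0..<m}"
      using tp m p \<open>k \<ge> 2\<close> by (force simp: D_def)
    moreover have "finite D" by (simp add: D_def)
    ultimately have "card J = card ((UNIV :: bool set) \<times> {0..<k} \<times> {0..<m}) - card D"
      unfolding J_def by (intro card_Diff_subset)
    moreover have "card D = nat (m - 1) + 2"
    proof -
      have "card ((\<lambda>t. (True, t * p, 0 :: int)) ` {0..<m - 1}) = nat (m - 1)"
        using p by (subst card_image) (auto simp: inj_on_def)
      moreover have "(\<lambda>t. (True, t * p, 0)) ` {0..<m - 1} \<inter> {(True, k - 1, 0), (False, k - 1, 0 :: int)} = {}"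
        using tp by force
      ultimately show ?thesis unfolding D_def by (subst card_Un_disjoint) auto
    qed
    moreover have "card I = nat k * nat m + nat (k - 1) * nat m"
      unfolding I_def by (subst card_Un_disjoint) (auto simp: card_cartesian_product)
    moreover have "nat k * nat m = nat (k - 1) * nat m + nat m"
    proof -
      have "nat k = Suc (nat (k - 1))" using \<open>k \<ge> 2\<close> by simp
      then show ?thesis by simp
    qed
    moreover have "card ((UNIV :: bool set) \<times> {0..<k} \<times> {0..<m}) = 2 * (nat k * nat m)"
      by (simp add: card_cartesian_product)
    moreover have "nat m = nat (m - 1) + 1" using m by simp
    ultimately show ?thesis by linarith
  qed
  moreover have "finite J" "finite I" by (simp_all add: J_def I_def)
  moreover have "L j (\<lambda>i. a * \<phi> i + b * \<psi> i) = a * L j \<phi> + b * L j \<psi>" for j \<phi> \<psi> a b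
    by (cases j) (simp add: L_def res_def algebra_simps)
  ultimately obtain \<phi> where \<phi>: "\<And>i. i \<notin> I \<Longrightarrow> \<phi> i = 0" "\<exists>i. \<phi> i \<noteq> 0" "\<And>j. j \<in> J \<Longrightarrow> L j \<phi> = 0"
    using nontrivial_solution[of J I L] by metis
  define f g where "f c n = \<phi> (False, c, n mod m)" and "g c n = \<phi> (True, c, n mod m)" for c n
  let ?r = "res \<phi>"
  have res: "?r e c n = f c n * hc e (V c n) - f c (n + 1) * hc e (V c (n + 1))
      - g c n * hc e (H c n) + g (c - 1) n * hc e (H (c - 1) n)" for e c n
    by (simp add: res_def f_def g_def)
  have ends: "g (- 1) n = 0" "g (k - 1) n = 0" for n
    unfolding g_def by (intro \<phi>(1); simp add: I_def)+
  \<comment> \<open>The net vector passing from column \<open>c\<close> to \<open>c + 1\<close> in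
    one period; the vertical terms telescope away.\<close>
  define G where "G e c = (\<Sum>n\<in>{0..<m}. g c n * hc e (H c n))" for e c
  have sum_res: "(\<Sum>n\<in>{0..<m}. ?r e c n) = G e (c - 1) - G e c" for e c
  proof -
    have "(\<Sum>n\<in>{0..<m}. f c n * hc e (V c n) - f c (n + 1) * hc e (V c (n + 1))) = 0"
      using perV[of c 0] m
      by (subst sum_telescope_int[where F = "\<lambda>n. f c n * hc e (V c n)"]) (simp_all add: f_def)
    then show ?thesis
      unfolding res G_def by (simp add: sum.distrib sum_subtractf)
  qed
  have column: "?r e c n = 0"
    if c: "0 \<le> c" "c < k" and n: "n \<in> {0..<m}" and G0: "\<And>e. G e (c - 1) = 0" for e c n
  proof -
    \<comment> \<open>The coordinate chosen by \<open>H c 0 = Infty\<close> is one where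
      \<open>H c 0\<close> has entry 1, so together with the determinant it controls the whole
      residual.\<close>
    have both: "?r e c n = 0" if "L (True, c, n) \<phi> = 0" "L (False, c, n) \<phi> = 0" for e c n
      using that by (cases "H c 0"; cases e) (auto simp: L_def)
    have nonzero_row: "?r e c n = 0" if "n \<in> {0..<m}" "n \<noteq> 0" for e n
      by (intro both \<phi>(3)) (use that c in \<open>auto simp: J_def D_def\<close>)
    have first: "?r e c 0 = - G e c" for e
    proof -
      have "(\<Sum>n\<in>{0..<m}. ?r e c n) = ?r e c 0 + (\<Sum>n\<in>{0..<m} - {0}. ?r e c n)"
        using m by (intro sum.remove) auto
      also have "(\<Sum>n\<in>{0..<m} - {0}. ?r e c n) = 0"
        using nonzero_row by (intro sum.neutral) auto
      finally show ?thesis using sum_res[of e c] G0 by simp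
    qed
    consider "n \<noteq> 0" | "n = 0" "c = k - 1" | "n = 0" "c \<noteq> k - 1" "p dvd c" | "n = 0" "c \<noteq> k - 1" "\<not> p dvd c"
      by blast
    then show ?thesis
    proof cases
      case 1
      with nonzero_row n show ?thesis by simp
    next
      case 2
      with first ends show ?thesis by (simp add: G_def)
    next
      case 3
      \<comment> \<open>Equal points make \<open>G\<close> a multiple of \<open>H c 0\<close>, so
        the omitted determinant equation holds automatically.\<close>
      have "H c n = H c 0" for n
        using periodic_shift[of "H c" 1 0 n] const[OF \<open>p dvd c\<close>] by simp
      then have "G e c = (\<Sum>n\<in>{0..<m}. g c n) * hc e (H c 0)" for e
        unfolding G_def sum_distrib_right by metis
      then have "L (True, c, 0) \<phi> = 0" by (simp add: L_def first)
      moreover have "L (False, c, 0) \<phi> = 0"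
        by (intro \<phi>(3)) (use 3 c m in \<open>auto simp: J_def D_def\<close>)
      ultimately show ?thesis using both 3 by simp
    next
      case 4
      have "(b, c, 0) \<in> J" for b using 4 c m by (auto simp: J_def D_def)
      then show ?thesis using both \<phi>(3) 4 by simp
    qed
  qed
  \<comment> \<open>Columns are treated from left to right: no net inflow makes all residuals of a
    column vanish, hence there is no net outflow.\<close>
  have G0: "c < k \<longrightarrow> (\<forall>e. G e (c - 1) = 0)" if "0 \<le> c" for c
    using that
  proof (induction c rule: int_ge_induct)
    case base
    show ?case using ends by (simp add: G_def)
  next
    case (step c)
    show ?case
    proof (intro impI allI)
      fix e assume "c + 1 < k"
      with step have "G e (c - 1) = 0" "\<And>n. n \<in> {0..<m} \<Longrightarrow> ?r e c n = 0"
        by (auto intro!: column)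
      with sum_res[of e c] show "G e (c + 1 - 1) = 0" by simp
    qed
  qed
  have res0: "?r e c n = 0" if c: "0 \<le> c" "c < k" for e c n
  proof -
    have "V c (n' mod m + d) = V c (n' + d)" "H c (n' mod m) = H c n'" for c n' d
      using periodic_shift[of "V c" m, OF perV, of "n' mod m + d" "n' div m"]
        periodic_shift[of "H c" m, OF perH, of "n' mod m" "n' div m"]
      by (simp_all add: algebra_simps)
    from this[of _ n] this(1)[of _ n 0] have "?r e c n = ?r e c (n mod m)"
      by (simp add: res f_def g_def mod_simps)
    also have "\<dots> = 0" using c m G0[of c] by (intro column) auto
    finally show ?thesis .
  qed
  have flow: "strip_flow (k - 1) V H f g"
    using res0 ends by (auto simp: strip_flow_def res algebra_simps)
  moreover have "\<exists>c\<in>{0..k - 1}. \<exists>n. f c n \<noteq> 0"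
  proof (rule ccontr)
    assume "\<not> ?thesis"
    then have f0: "f c n = 0" if "0 \<le> c" "c < k" for c n using that by force
    \<comment> \<open>Without vertical weights, the horizontal weights vanish successively from the
      left end.\<close>
    have g0: "c < k \<longrightarrow> (\<forall>n. g (c - 1) n = 0)" if "0 \<le> c" for c
      using that
    proof (induction c rule: int_ge_induct)
      case base
      show ?case using ends by simp
    next
      case (step c)
      show ?case
      proof (intro impI allI)
        fix n assume "c + 1 < k"
        obtain e where "hc e (H c n) \<noteq> 0" using hc_nonzero by blast
        with res0[of c e n] step f0[of c] \<open>c + 1 < k\<close> show "g (c + 1 - 1) n = 0"
          by (simp add: res)
      qed
    qed
    have "\<phi> i = 0" for i
    proof (cases "i \<in> I")
      case True
      obtain b c n where "i = (b, c, n)" by (cases i)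
      with True have i: "i = (b, c, n)" "0 \<le> c" "c < k" "b \<longrightarrow> c < k - 1" "n mod m = n"
        by (auto simp: I_def)
      show ?thesis
        using f0[of c n] g0[of "c + 1"] i by (cases b) (auto simp: f_def g_def dest!: spec[of _ n])
    qed (use \<phi>(1) in blast)
    with \<phi>(2) show False by blast
  qed
  ultimately show thesis by (rule that)
qed

section \<open>From Devron data up to level \<open>k\<close>\<close>

theorem theorem1p6:
  fixes m p k :: int
    and x :: "int \<times> int \<times> int \<Rightarrow> ext_complex"
  assumes "m \<ge> 2" and "p \<ge> 1"
    and "satisfies_dSKP x"
    and "Devron_data m p (initial_data x)"
    and "k = (m - 2) * p + 2"
    and well_defined: "\<And>i j l. (i, j, l) \<notin> oct_lattice \<Longrightarrow> 1 \<le> l \<Longrightarrow> l < k \<Longrightarrow> dSKP_determines_up x (i, j, l)"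
  shows "\<forall>i j. (i - j - m * p) mod (2 * p) = 0 \<longrightarrow> x (i, j, k) = x (i + 1, j + 1, k)"
proof (intro allI impI)
  fix i j
  assume ij: "(i - j - m * p) mod (2 * p) = 0"
  \<comment> \<open>\<open>n\<close> runs along the diagonal and \<open>c\<close> across it; the
    offsets put \<open>x (i, j, k)\<close> at \<open>V (k - 1) 0 0\<close>.\<close>
  define V where "V l c n = x (i - k + 1 + l + c + n, j - c + n, l + 1)" for l c n
  define H where "H l c n = x (i - k + 2 + l + c + n, j - c + n, l)" for l c n
  note m = assms(1) and p = assms(2) and k = assms(5)
  \<comment> \<open>This congruence fixes the parity of the strip and, in the base case, puts its
    columns divisible by \<open>p\<close> on the diagonals where the data are constant.\<close>
  from ij obtain w where w: "i - j - m * p = 2 * p * w" by (metis mod_0_imp_dvd dvdE)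
  have parity: "even (i - k + 2 + c + n + (j - c + n))" for c n
  proof -
    have "i - k + 2 + c + n + (j - c + n) = 2 * (j + p + p * w + n)"
      using w k by (simp add: algebra_simps)
    then show ?thesis by (metis dvd_triv_left)
  qed
  have parity': "odd (i - k + 1 + c + n + (j - c + n))" for c n
    using parity[of c n] by presburger
  have V0: "V 0 c n = initial_data x (i - k + 1 + c + n) (j - c + n)" for c n
    using parity'[of c n] unfolding V_def initial_data_def odd_iff_mod_2_eq_one by simp
  have H0: "H 0 c n = initial_data x (i - k + 2 + c + n) (j - c + n)" for c n
    using parity[of c n] unfolding H_def initial_data_def even_iff_mod_2_eq_zero by simp
  have not_in: "(i - k + 2 + l + c + n, j - c + n, l + 1) \<notin> oct_lattice" for l c n
  proof -
    have eq: "i - k + 2 + l + c + n + (j - c + n) + (l + 1) = 2 * (j + p + p * w + n + l) + 1"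
      using w k by (simp add: algebra_simps)
    have "odd (i - k + 2 + l + c + n + (j - c + n) + (l + 1))"
      unfolding eq by simp
    then show ?thesis by (simp only: oct_lattice_def mem_Collect_eq case_prod_conv not_False_eq_True)
  qed
  have center: "\<exists>!y. dSKP_rel (H l c n) (V l c (n + 1)) (V l c n) y (V l (c + 1) n) (V l (c + 1) (n + 1))"
    if "0 \<le> l" "l < k - 1" for l c n
    using well_defined[OF not_in[of l c n]] that
    by (simp add: dSKP_determines_up_def V_def H_def e1_def e2_def e3_def algebra_simps)
  have rel: "dSKP_rel (H l c n) (V l c (n + 1)) (V l c n) (V (l + 1) c n) (V l (c + 1) n) (V l (c + 1) (n + 1))"
    for l c n
  proof -
    from not_in[of l c n] assms(3) have "dSKP_rel
      (x ((i - k + 2 + l + c + n, j - c + n, l + 1) - e3))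
      (x ((i - k + 2 + l + c + n, j - c + n, l + 1) + e2))
      (x ((i - k + 2 + l + c + n, j - c + n, l + 1) - e1))
      (x ((i - k + 2 + l + c + n, j - c + n, l + 1) + e3))
      (x ((i - k + 2 + l + c + n, j - c + n, l + 1) - e2))
      (x ((i - k + 2 + l + c + n, j - c + n, l + 1) + e1))"
      unfolding satisfies_dSKP_def by blast
    then show ?thesis
      by (simp add: V_def H_def e1_def e2_def e3_def algebra_simps)
  qed
  have H_Suc: "H (l + 1) = (\<lambda>c n. V l (c + 1) (n + 1))" for l
    by (simp add: H_def V_def fun_eq_iff algebra_simps)
  have flow: "\<exists>f g. strip_flow (k - 1 - l) (V l) (H l) f g \<and> (\<exists>c\<in>{0..k - 1 - l}. \<exists>n. f c n \<noteq> 0)"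
    if "0 \<le> l" "l \<le> k - 1" for l
    using that
  proof (induction l rule: int_ge_induct)
    case base
    have D1: "initial_data x a b = initial_data x (a + m) (b + m)" for a b
      using assms(4) unfolding Devron_data_def by blast
    have D2: "initial_data x a b = initial_data x (a + 1) (b + 1)" if "(a - b) mod (2 * p) = 0" for a b
      by (rule assms(4)[unfolded Devron_data_def, THEN conjunct2, rule_format, OF that])
    have "V 0 c (n + m) = V 0 c n" "H 0 c (n + m) = H 0 c n" for c n
      using D1[of "i - k + 1 + c + n" "j - c + n"] D1[of "i - k + 2 + c + n" "j - c + n"]
      by (simp_all add: V0 H0 algebra_simps)
    moreover have "H 0 c (n + 1) = H 0 c n" if "p dvd c" for c n
    proof -
      from that obtain t where "c = p * t" by blast
      then have "i - k + 2 + c + n - (j - c + n) = 2 * p * (w + 1 + t)"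
        using w k by (simp add: algebra_simps)
      then have "(i - k + 2 + c + n - (j - c + n)) mod (2 * p) = 0" by simp
      from D2[OF this] show ?thesis by (simp add: H0 algebra_simps)
    qed
    ultimately show ?case
      using Devron_strip_flow[OF m p k, of "V 0" "H 0"] by (metis diff_zero)
  next
    case (step l)
    then obtain f g where f: "strip_flow (k - 1 - l) (V l) (H l) f g"
      and nz: "\<exists>c\<in>{0..k - 1 - l}. \<exists>n. f c n \<noteq> 0" by force
    have l: "0 \<le> l" "l < k - 1" and N: "1 \<le> k - 1 - l" using step by auto
    \<comment> \<open>For \<open>l = k - 2\<close> there is no such \<open>c\<close>; otherwise
      \<open>l + 1 < k - 1\<close> and \<open>center\<close> applies.\<close>
    have next_center: "\<exists>!y. dSKP_rel (V l (c + 1) (n + 1)) (V (l + 1) c (n + 1)) (V (l + 1) c n) y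
        (V (l + 1) (c + 1) n) (V (l + 1) (c + 1) (n + 1))" if "0 \<le> c" "c + 1 < k - 1 - l" for c n
      using center[of "l + 1" c n] that l by (simp add: H_Suc)
    obtain f' g' where "strip_flow (k - 1 - l - 1) (V (l + 1)) (H (l + 1)) f' g'"
      "\<exists>c\<in>{0..k - 1 - l - 1}. \<exists>n. f' c n \<noteq> 0"
      unfolding H_Suc by (rule strip_flow_step[OF N f nz center[OF l] rel next_center])
    then show ?case by (auto simp: algebra_simps)
  qed
  from flow[of "k - 1"] m p k obtain f g n0 where "strip_flow 0 (V (k - 1)) (H (k - 1)) f g"
    and n0: "f 0 n0 \<noteq> 0" by auto
  then have eq: "f 0 n * hc e (V (k - 1) 0 n) = f 0 (n + 1) * hc e (V (k - 1) 0 (n + 1))" for e n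
    unfolding strip_flow_def by fastforce
  \<comment> \<open>A nonzero weight anywhere in the single column spreads to all rows, in
    particular to row \<open>0\<close>.\<close>
  have zero_iff: "f 0 n = 0 \<longleftrightarrow> f 0 (n + 1) = 0" for n
    using eq[of n] hc_nonzero by (metis mult_eq_0_iff)
  have "f 0 0 \<noteq> 0"
    using n0 periodic_shift[of "\<lambda>n. f 0 n = 0" 1 0 n0] zero_iff by simp
  from hc_proportional[OF this eq] have "V (k - 1) 0 0 = V (k - 1) 0 1" by simp
  then show "x (i, j, k) = x (i + 1, j + 1, k)" by (simp add: V_def)
qed

end
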